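(* Let $n$ be a positive integer, let $0\le\alpha\le\frac{\pi}{4}$, $T=\tan(\alpha)$, and $\beta=\frac{1}{n}\arccos\left(\frac{2T^n}{1+T^{2n}}\right)$. Then $$l=2^{1+\frac{1}{n}}\,a,$$ where $l$ is the length of the arc of the sinusoidal spiral $r^n=\cos(n\theta)$ within the polar sector $\beta\le\theta\le\frac{\pi}{2n}$, and $a$ is the area of the radial sector of the Lamé curve $x^{2n}+y^{2n}=1$ within $0\le\theta\le\alpha$.
   Context: Here $(r,\theta)$ are polar coordinates in the plane. The sinusoidal spiral is the curve with polar equation $r^n=\cos(n\theta)$, $r\ge 0$; its arc in the polar sector $\beta\le\theta\le\frac{\pi}{2n}$ is the curve $\theta\mapsto(r\cos\theta,r\sin\theta)$ with $r=(\cos(n\theta))^{1/n}$ for $\theta$ in that interval. The radial sector of the Lamé curve within $0\le\theta\le\alpha$ is the region of points with polar angle between $0$ and $\alpha$ lying between the origin and the curve, i.e. the points $(x,y)=(\rho\cos\theta,\rho\sin\theta)$ with $0\le\theta\le\alpha$, $\rho\ge 0$, and $x^{2n}+y^{2n}\le 1$. *)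

theory Defs
  imports "HOL-Analysis.Analysis"
begin

(* Supremum of the lengths of inscribed polygons, over all partitions
   a = t 0 <= t 1 <= ... <= t N = b.  The value is finite iff the curve is rectifiable.
   The Euclidean plane is real * real, whose library metric is the Euclidean one. *)
definition curve_length :: "(real \<Rightarrow> 'a::metric_space) \<Rightarrow> real \<Rightarrow> real \<Rightarrow> ennreal" where
  "curve_length \<gamma> a b =
     (SUP (t, N) \<in> {(t :: nat \<Rightarrow> real, N :: nat). t 0 = a \<and> t N = b \<and> (\<forall>i<N. t i \<le> t (Suc i))}.
        \<Sum>i<N. ennreal (dist (\<gamma> (t i)) (\<gamma> (t (Suc i)))))"

(* Used only where cos (n * \<theta>) \<ge> 0, so root is the nonnegative n-th root. *)
definition sinusoidal_spiral :: "nat \<Rightarrow> real \<Rightarrow> real \<times> real" where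
  "sinusoidal_spiral n \<theta> =
     (let r = root n (cos (real n * \<theta>)) in (r * cos \<theta>, r * sin \<theta>))"

definition lame_sector :: "nat \<Rightarrow> real \<Rightarrow> (real \<times> real) set" where
  "lame_sector n \<alpha> =
     {(x, y). x ^ (2 * n) + y ^ (2 * n) \<le> 1 \<and>
        (\<exists>\<rho> \<theta>. 0 \<le> \<theta> \<and> \<theta> \<le> \<alpha> \<and> 0 \<le> \<rho> \<and> x = \<rho> * cos \<theta> \<and> y = \<rho> * sin \<theta>)}"

end

theory Submission
  imports Defs
begin

text \<open>
  The proof compares both quantities with the integral of \<open>(1 + t^(2n))^(-1/n)\<close> over \<open>[0, T]\<close>.

  On the side of the spiral, the polar angle is a poor parameter: the speed is \<open>cos(n\<theta>)^(1/n - 1)\<close>,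
  which for \<open>n \<ge> 2\<close> is unbounded near the endpoint \<open>\<theta> = pi/(2n)\<close>. The formula for
  \<open>\<beta>\<close> suggests a better one. Substituting \<open>cos(n\<theta>) = 2t^n/(1 + t^(2n))\<close>, that is
  \<open>n\<theta> = pi/2 - 2 arctan(t^n)\<close>, turns the arc into a \<open>C\<^sup>1\<close> curve on \<open>[0, T]\<close>, traversed
  backwards, with polar radius \<open>r = 2^(1/n) t (1 + t^(2n))^(-1/n)\<close>. With \<open>u = t^n\<close> and
  \<open>v = 2^(1/n) (1 + u\<^sup>2)^(-1/n)\<close>, the radial and angular components of its velocity are
  \<open>v (1 - u\<^sup>2)/(1 + u\<^sup>2)\<close> and \<open>- v 2u/(1 + u\<^sup>2)\<close>, so its speed is \<open>v\<close> by the identity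
  \<open>(1 - u\<^sup>2)\<^sup>2 + (2u)\<^sup>2 = (1 + u\<^sup>2)\<^sup>2\<close>. Hence the length is \<open>2^(1/n)\<close> times the integral. This is
  \<open>curve_length_sinusoidal_spiral\<close>; it rests on the facts that polygonal length is the
  integral of the speed for \<open>C\<^sup>1\<close> curves (\<open>curve_length_eq_integral_speed\<close>) and is unchanged when
  the parameter interval is run through in the opposite direction
  (\<open>curve_length_antitone_reparametrization\<close>).

  On the side of the Lame curve, use the abscissa \<open>x\<close> and the slope \<open>m = y/x\<close> as coordinates; the
  area element is \<open>x dx dm\<close> (\<open>emeasure_slope_coordinates\<close>). For a slope \<open>m\<close> in \<open>[0, T]\<close> the sector
  contains exactly the abscissas from \<open>0\<close> to \<open>c = (1 + m^(2n))^(-1/(2n))\<close>, and these contribute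
  \<open>c\<^sup>2/2\<close>. So the area is half of the integral (\<open>measure_lame_sector\<close>).
\<close>

section \<open>Polygonal length of curves\<close>

lemma partition_le:
  fixes t :: "nat \<Rightarrow> real"
  assumes "\<forall>i<N. t i \<le> t (Suc i)" "i \<le> j" "j \<le> N"
  shows "t i \<le> t j"
  using assms(2,3)
proof (induction j rule: dec_induct)
  case (step m)
  then show ?case using assms(1) by (meson Suc_le_eq le_trans less_imp_le_nat order_trans)
qed simp

lemma integral_partition:
  fixes f :: "real \<Rightarrow> real"
  assumes f: "f integrable_on {t 0..t N}" and t: "\<forall>i<N. t i \<le> t (Suc i)"
  shows "integral {t 0..t N} f = (\<Sum>i<N. integral {t i..t (Suc i)} f)"
proof -
  have "integral {t 0..t k} f = (\<Sum>i<k. integral {t i..t (Suc i)} f)" if "k \<le> N" for k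
    using that
  proof (induction k)
    case (Suc k)
    have "f integrable_on {t 0..t (Suc k)}"
      by (rule integrable_on_subinterval[OF f]) (use partition_le[OF t, of "Suc k" N] Suc.prems in auto)
    then have "integral {t 0..t (Suc k)} f = integral {t 0..t k} f + integral {t k..t (Suc k)} f"
      using partition_le[OF t, of 0 k] t Suc.prems
      by (intro Henstock_Kurzweil_Integration.integral_combine[symmetric]) auto
    then show ?case using Suc by simp
  qed simp
  then show ?thesis by simp
qed

text \<open>
  A chord is never longer than the integral of the speed over its parameter interval, since it is the
  norm of the integral of the velocity. Conversely, on a short interval the velocity is nearly
  constant by uniform continuity, and for a constant velocity the two agree; so a sufficiently fine
  equidistant partition loses arbitrarily little.
\<close>
lemma curve_length_eq_integral_speed:
  fixes g :: "real \<Rightarrow> 'a::euclidean_space"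
  assumes ab: "a \<le> b"
    and deriv: "\<And>t. t \<in> {a..b} \<Longrightarrow> (g has_vector_derivative g' t) (at t within {a..b})"
    and cont: "continuous_on {a..b} g'"
  shows "curve_length g a b = ennreal (integral {a..b} (\<lambda>t. norm (g' t)))"
proof (rule antisym)
  let ?v = "\<lambda>t. norm (g' t)"
  have speed_int: "?v integrable_on {a..b}"
    by (intro integrable_continuous_real continuous_intros cont)
  have speed_int_sub: "?v integrable_on {c..d}" if "a \<le> c" "d \<le> b" for c d
    using integrable_on_subinterval[OF speed_int] that by auto
  have FTC: "(g' has_integral g d - g c) {c..d}" if "a \<le> c" "c \<le> d" "d \<le> b" for c d
    using that by (intro fundamental_theorem_of_calculus)
      (auto intro!: has_vector_derivative_within_subset[OF deriv])
  have chord: "dist (g c) (g d) \<le> integral {c..d} ?v" if cd: "a \<le> c" "c \<le> d" "d \<le> b" for c d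
  proof -
    have "norm (integral {c..d} g') \<le> integral {c..d} ?v"
      using FTC[OF cd] speed_int_sub[of c d] cd by (intro integral_norm_bound_integral) auto
    then show ?thesis
      using integral_unique[OF FTC[OF cd]] by (simp add: dist_norm norm_minus_commute)
  qed
  show "curve_length g a b \<le> ennreal (integral {a..b} ?v)"
    unfolding curve_length_def
  proof (rule SUP_least, clarify)
    fix t :: "nat \<Rightarrow> real" and N
    assume ends: "a = t 0" "b = t N" and t: "\<forall>i<N. t i \<le> t (Suc i)"
    have "(\<Sum>i<N. dist (g (t i)) (g (t (Suc i)))) \<le> (\<Sum>i<N. integral {t i..t (Suc i)} ?v)"
      using ends t partition_le[OF t] by (intro sum_mono chord) auto
    also have "\<dots> = integral {a..b} ?v"
      using integral_partition[OF _ t, of ?v] speed_int ends by simp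
    finally show "(\<Sum>i<N. ennreal (dist (g (t i)) (g (t (Suc i))))) \<le> ennreal (integral {t 0..t N} ?v)"
      using ends by (simp add: sum_ennreal ennreal_leI)
  qed
  show "ennreal (integral {a..b} ?v) \<le> curve_length g a b"
  proof (rule ennreal_le_epsilon)
    fix e :: real assume "0 < e"
    \<comment> \<open>The total loss will be \<open>2 * \<epsilon> * (b - a)\<close>; the added \<open>1\<close> covers the case \<open>a = b\<close>.\<close>
    define \<epsilon> where "\<epsilon> = e / (2 * (b - a) + 1)"
    have \<epsilon>: "\<epsilon> > 0" and \<epsilon>_e: "2 * \<epsilon> * (b - a) \<le> e"
      using \<open>0 < e\<close> ab by (auto simp: \<epsilon>_def field_simps)
    have "uniformly_continuous_on {a..b} g'"
      using cont by (intro compact_uniformly_continuous) auto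
    then obtain \<delta> where \<delta>: "\<delta> > 0"
      and uc: "\<And>s t. s \<in> {a..b} \<Longrightarrow> t \<in> {a..b} \<Longrightarrow> dist s t < \<delta> \<Longrightarrow> dist (g' s) (g' t) < \<epsilon>"
      using \<epsilon> unfolding uniformly_continuous_on_def by metis
    have short: "integral {c..d} ?v \<le> dist (g c) (g d) + 2 * \<epsilon> * (d - c)"
      if cd: "a \<le> c" "c \<le> d" "d \<le> b" and "d - c < \<delta>" for c d
    proof -
      have near: "norm (g' s - g' c) \<le> \<epsilon>" if "s \<in> {c..d}" for s
        using uc[of s c] that cd \<open>d - c < \<delta>\<close> by (force simp: dist_norm)
      have "((\<lambda>s. g' s - g' c) has_integral (g d - g c - (d - c) *\<^sub>R g' c)) (cbox c d)"
        using has_integral_diff[OF FTC[OF cd] has_integral_const_real[of "g' c" c d]] cd by simp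
      then have lin: "norm (g d - g c - (d - c) *\<^sub>R g' c) \<le> \<epsilon> * (d - c)"
        using has_integral_bound[of \<epsilon> "\<lambda>s. g' s - g' c" _ c d] near \<epsilon> cd by auto
      \<comment> \<open>Replacing the velocity by its value at \<open>c\<close> costs \<open>\<epsilon> * (d - c)\<close> in the integral of the speed
        and the same amount again in the chord.\<close>
      have "integral {c..d} ?v \<le> integral {c..d} (\<lambda>_. norm (g' c) + \<epsilon>)"
      proof (rule integral_le)
        show "norm (g' s) \<le> norm (g' c) + \<epsilon>" if "s \<in> {c..d}" for s
          using near[OF that] norm_triangle_sub[of "g' s" "g' c"] by linarith
      qed (use speed_int_sub cd in auto)
      also have "\<dots> = norm ((d - c) *\<^sub>R g' c) + \<epsilon> * (d - c)"
        using cd by (simp add: distrib_left)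
      also have "\<dots> \<le> norm (g d - g c) + 2 * \<epsilon> * (d - c)"
        using lin norm_triangle_sub[of "(d - c) *\<^sub>R g' c" "g d - g c"]
        by (simp add: norm_minus_commute)
      finally show ?thesis by (simp add: dist_norm norm_minus_commute)
    qed
    obtain N :: nat where "(b - a) / \<delta> < real N"
      using reals_Archimedean2 by blast
    moreover have "0 \<le> (b - a) / \<delta>" using ab \<delta> by simp
    ultimately have N: "(b - a) / \<delta> < real N" "N > 0" by linarith+
    define t where "t = (\<lambda>i. a + real i * ((b - a) / real N))"
    have ends: "t 0 = a" "t N = b" using N by (auto simp: t_def)
    have gap: "t (Suc i) - t i = (b - a) / real N" for i 
      by (simp add: t_def distrib_right add_divide_distrib)
    have "0 \<le> (b - a) / real N" using ab by simp
    then have t: "\<forall>i<N. t i \<le> t (Suc i)"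
      using gap by (metis diff_ge_0_iff_ge)
    have fine: "t (Suc i) - t i < \<delta>" for i
      using N \<delta> unfolding gap by (simp add: field_simps)
    have "integral {a..b} ?v = (\<Sum>i<N. integral {t i..t (Suc i)} ?v)"
      using integral_partition[OF _ t, of ?v] speed_int ends by simp
    also have "\<dots> \<le> (\<Sum>i<N. dist (g (t i)) (g (t (Suc i))) + 2 * \<epsilon> * (t (Suc i) - t i))"
      using ends t partition_le[OF t, of 0] partition_le[OF t, of _ N]
      by (intro sum_mono short fine) auto
    also have "\<dots> = (\<Sum>i<N. dist (g (t i)) (g (t (Suc i)))) + 2 * \<epsilon> * (b - a)"
      by (simp only: sum.distrib sum_distrib_left[symmetric] sum_lessThan_telescope ends)
    also have "\<dots> \<le> (\<Sum>i<N. dist (g (t i)) (g (t (Suc i)))) + e"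
      using \<epsilon>_e by simp
    finally have "ennreal (integral {a..b} ?v)
        \<le> (\<Sum>i<N. ennreal (dist (g (t i)) (g (t (Suc i))))) + ennreal e"
      using \<open>0 < e\<close> by (simp add: sum_ennreal ennreal_plus[symmetric] sum_nonneg ennreal_leI
          del: ennreal_plus)
    also have "(\<Sum>i<N. ennreal (dist (g (t i)) (g (t (Suc i))))) \<le> curve_length g a b"
      unfolding curve_length_def by (rule SUP_upper2[of "(t, N)"]) (use ends t in auto)
    finally show "ennreal (integral {a..b} ?v) \<le> curve_length g a b + ennreal e"
      by (simp add: add_right_mono)
  qed
qed

text \<open>
  A strictly decreasing continuous \<open>\<phi>\<close> is a bijection between the parameter intervals, so partitions
  of one correspond to partitions of the other with the order of their points reversed, and the
  inscribed polygons are the same.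
\<close>
lemma curve_length_antitone_reparametrization:
  fixes \<gamma> :: "real \<Rightarrow> 'a::metric_space"
  assumes ab: "a \<le> b" and cont: "continuous_on {a..b} \<phi>"
    and anti: "\<And>s t. a \<le> s \<Longrightarrow> s < t \<Longrightarrow> t \<le> b \<Longrightarrow> \<phi> t < \<phi> s"
  shows "curve_length \<gamma> (\<phi> b) (\<phi> a) = curve_length (\<gamma> \<circ> \<phi>) a b"
proof (rule antisym)
  have reverse: "(\<Sum>i<N. ennreal (dist (f (N - i)) (f (N - Suc i)))) =
      (\<Sum>i<N. ennreal (dist (f i) (f (Suc i))))" for f :: "nat \<Rightarrow> 'a" and N
  proof -
    have "(\<Sum>i<N. ennreal (dist (f i) (f (Suc i)))) =
        (\<Sum>i<N. ennreal (dist (f (N - Suc i)) (f (Suc (N - Suc i)))))"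
      by (rule sum.nat_diff_reindex[symmetric])
    also have "\<dots> = (\<Sum>i<N. ennreal (dist (f (N - i)) (f (N - Suc i))))"
      by (intro sum.cong) (auto simp: dist_commute Suc_diff_Suc)
    finally show ?thesis by simp
  qed
  \<comment> \<open>A partition \<open>t\<close> of \<open>[a, b]\<close> is pushed forward to \<open>i \<mapsto> \<phi> (t (N - i))\<close>.\<close>
  show "curve_length (\<gamma> \<circ> \<phi>) a b \<le> curve_length \<gamma> (\<phi> b) (\<phi> a)"
    unfolding curve_length_def[of "\<gamma> \<circ> \<phi>"]
  proof (rule SUP_least, clarify)
    fix t :: "nat \<Rightarrow> real" and N
    assume ends: "a = t 0" "b = t N" and t: "\<forall>i<N. t i \<le> t (Suc i)"
    have "\<phi> (t (N - i)) \<le> \<phi> (t (N - Suc i))" if "i < N" for i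
    proof -
      have "t (N - Suc i) \<le> t (N - i)" "a \<le> t (N - Suc i)" "t (N - i) \<le> b"
        using partition_le[OF t] ends that by auto
      then show ?thesis using anti by (cases "t (N - Suc i) = t (N - i)") (auto simp: less_imp_le)
    qed
    then have "(\<Sum>i<N. ennreal (dist (\<gamma> (\<phi> (t (N - i)))) (\<gamma> (\<phi> (t (N - Suc i))))))
        \<le> curve_length \<gamma> (\<phi> b) (\<phi> a)"
      unfolding curve_length_def
      by (intro SUP_upper2[of "(\<lambda>i. \<phi> (t (N - i)), N)"]) (use ends in auto)
    then show "(\<Sum>i<N. ennreal (dist ((\<gamma> \<circ> \<phi>) (t i)) ((\<gamma> \<circ> \<phi>) (t (Suc i)))))
        \<le> curve_length \<gamma> (\<phi> (t N)) (\<phi> (t 0))"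
      using reverse[of "\<lambda>i. \<gamma> (\<phi> (t i))" N] ends by simp
  qed
  \<comment> \<open>A partition of \<open>[\<phi> b, \<phi> a]\<close> is pulled back pointwise by the intermediate value theorem;
    strictness of \<open>\<phi>\<close> forces the preimages to be ordered and to start and end at the endpoints.\<close>
  show "curve_length \<gamma> (\<phi> b) (\<phi> a) \<le> curve_length (\<gamma> \<circ> \<phi>) a b"
    unfolding curve_length_def[of \<gamma>]
  proof (rule SUP_least, clarify)
    fix s :: "nat \<Rightarrow> real" and N
    assume ends: "s 0 = \<phi> b" "s N = \<phi> a" and s: "\<forall>i<N. s i \<le> s (Suc i)"
    have "\<exists>u. a \<le> u \<and> u \<le> b \<and> \<phi> u = s i" if "i \<le> N" for i
      using IVT2'[of \<phi> b "s i" a] partition_le[OF s, of 0 i] partition_le[OF s, of i N]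
        ends that ab cont by auto
    then obtain u where u: "\<And>i. i \<le> N \<Longrightarrow> a \<le> u i \<and> u i \<le> b \<and> \<phi> (u i) = s i"
      by metis
    have u0: "u 0 = b" and uN: "u N = a"
      using u[of 0] u[of N] anti[of "u 0" b] anti[of a "u N"] ends by fastforce+
    have mono: "u (N - i) \<le> u (N - Suc i)" if "i < N" for i
    proof (rule ccontr)
      assume "\<not> ?thesis"
      then have "s (N - i) < s (N - Suc i)"
        using anti[of "u (N - Suc i)" "u (N - i)"] u[of "N - i"] u[of "N - Suc i"] by auto
      then show False using partition_le[OF s, of "N - Suc i" "N - i"] by force
    qed
    have "(\<Sum>i<N. ennreal (dist ((\<gamma> \<circ> \<phi>) (u (N - i))) ((\<gamma> \<circ> \<phi>) (u (N - Suc i)))))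
        \<le> curve_length (\<gamma> \<circ> \<phi>) a b"
      unfolding curve_length_def
      by (intro SUP_upper2[of "(\<lambda>i. u (N - i), N)"]) (use u0 uN mono in auto)
    moreover have "(\<Sum>i<N. ennreal (dist (\<gamma> (s i)) (\<gamma> (s (Suc i))))) =
        (\<Sum>i<N. ennreal (dist ((\<gamma> \<circ> \<phi>) (u i)) ((\<gamma> \<circ> \<phi>) (u (Suc i)))))"
      using u by (intro sum.cong) auto
    ultimately show "(\<Sum>i<N. ennreal (dist (\<gamma> (s i)) (\<gamma> (s (Suc i))))) \<le> curve_length (\<gamma> \<circ> \<phi>) a b"
      using reverse[of "\<lambda>i. (\<gamma> \<circ> \<phi>) (u i)" N] by simp
  qed
qed

section \<open>Area of the Lame sector\<close>

text \<open>
  Slice vertically, substitute \<open>y = x * m\<close> within the slice over each \<open>x \<noteq> 0\<close>, and exchange the two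
  integrals by Tonelli. The slice \<open>x = 0\<close>, where no slope is defined, is a null set.
\<close>
lemma emeasure_slope_coordinates:
  fixes S :: "(real \<times> real) set"
  assumes [measurable]: "S \<in> sets borel"
  shows "emeasure lborel S =
    (\<integral>\<^sup>+m. (\<integral>\<^sup>+x. ennreal \<bar>x\<bar> * indicator S (x, x * m) \<partial>lborel) \<partial>lborel)"
proof -
  have [measurable]: "S \<in> sets (lborel \<Otimes>\<^sub>M lborel)"
    using assms by (metis borel_prod sets_lborel sets_pair_measure_cong)
  have "emeasure lborel S = (\<integral>\<^sup>+z. indicator S z \<partial>(lborel \<Otimes>\<^sub>M lborel))"
    by (simp add: lborel_prod)
  also have "\<dots> = (\<integral>\<^sup>+x. (\<integral>\<^sup>+y. indicator S (x, y) \<partial>lborel) \<partial>lborel)"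
    by (rule lborel.nn_integral_fst[symmetric]) measurable
  also have "\<dots> = (\<integral>\<^sup>+x. (\<integral>\<^sup>+m. ennreal \<bar>x\<bar> * indicator S (x, x * m) \<partial>lborel) \<partial>lborel)"
  proof (rule nn_integral_cong_AE)
    have "AE x in lborel. x \<noteq> (0::real)" by (rule AE_lborel_singleton)
    then show "AE x in lborel. (\<integral>\<^sup>+y. indicator S (x, y) \<partial>lborel) =
        (\<integral>\<^sup>+m. ennreal \<bar>x\<bar> * indicator S (x, x * m) \<partial>lborel)"
    proof eventually_elim
      case (elim x)
      then show ?case
        using nn_integral_real_affine[of "\<lambda>y. indicator S (x, y)" x 0]
        by (simp add: nn_integral_cmult)
    qed
  qed
  also have "\<dots> = (\<integral>\<^sup>+m. (\<integral>\<^sup>+x. ennreal \<bar>x\<bar> * indicator S (x, x * m) \<partial>lborel) \<partial>lborel)"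
    by (rule lborel_pair.Fubini'[symmetric]) measurable
  finally show ?thesis .
qed

text \<open>
  Cartesian inequalities show that the sector is closed, hence measurable, and give
  its points of a prescribed slope directly.
\<close>
lemma lame_sector_eq:
  assumes "0 \<le> \<alpha>" "\<alpha> < pi / 2"
  shows "lame_sector n \<alpha> =
    {(x, y). x ^ (2 * n) + y ^ (2 * n) \<le> 1 \<and> 0 \<le> x \<and> 0 \<le> y \<and> y \<le> x * tan \<alpha>}"
proof -
  have "(\<exists>\<rho> \<theta>. 0 \<le> \<theta> \<and> \<theta> \<le> \<alpha> \<and> 0 \<le> \<rho> \<and> x = \<rho> * cos \<theta> \<and> y = \<rho> * sin \<theta>) \<longleftrightarrow>
      0 \<le> x \<and> 0 \<le> y \<and> y \<le> x * tan \<alpha>" for x y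
  proof
    assume "\<exists>\<rho> \<theta>. 0 \<le> \<theta> \<and> \<theta> \<le> \<alpha> \<and> 0 \<le> \<rho> \<and> x = \<rho> * cos \<theta> \<and> y = \<rho> * sin \<theta>"
    then obtain \<rho> \<theta> where *: "0 \<le> \<theta>" "\<theta> \<le> \<alpha>" "0 \<le> \<rho>" "x = \<rho> * cos \<theta>" "y = \<rho> * sin \<theta>"
      by blast
    have c: "cos \<theta> > 0" and s: "sin \<theta> \<ge> 0"
      using * assms by (auto intro!: cos_gt_zero_pi sin_ge_zero)
    have "tan \<theta> \<le> tan \<alpha>"
      using * assms by (intro tan_mono_le) auto
    then have "\<rho> * cos \<theta> * tan \<theta> \<le> \<rho> * cos \<theta> * tan \<alpha>"
      using * c by (intro mult_left_mono) auto
    then show "0 \<le> x \<and> 0 \<le> y \<and> y \<le> x * tan \<alpha>"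
      using * c s by (simp add: tan_def)
  next
    assume *: "0 \<le> x \<and> 0 \<le> y \<and> y \<le> x * tan \<alpha>"
    show "\<exists>\<rho> \<theta>. 0 \<le> \<theta> \<and> \<theta> \<le> \<alpha> \<and> 0 \<le> \<rho> \<and> x = \<rho> * cos \<theta> \<and> y = \<rho> * sin \<theta>"
    proof (cases "x = 0")
      case True
      then show ?thesis using * assms by (intro exI[of _ 0]) auto
    next
      case False
      define \<theta> where "\<theta> = arctan (y / x)"
      have "y / x \<le> tan \<alpha>" "0 \<le> y / x" using * False by (auto simp: field_simps)
      then have "0 \<le> \<theta>" "\<theta> \<le> \<alpha>"
        using arctan_monotone'[of "y / x" "tan \<alpha>"] assms
        by (auto simp: \<theta>_def arctan_tan)
      have c: "cos \<theta> > 0" and t: "tan \<theta> = y / x"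
        using cos_gt_zero_pi[OF arctan_lbound arctan_ubound]
        by (simp_all add: \<theta>_def tan_arctan)
      have "x = (x / cos \<theta>) * cos \<theta>" "y = (x / cos \<theta>) * sin \<theta>" "0 \<le> x / cos \<theta>"
        using c t * False by (auto simp: tan_def field_simps)
      then show ?thesis using \<open>0 \<le> \<theta>\<close> \<open>\<theta> \<le> \<alpha>\<close> by blast
    qed
  qed
  then show ?thesis unfolding lame_sector_def by auto
qed

text \<open>
  For fixed slope \<open>m\<close> the defining inequality reads
  \<open>x^(2n) (1 + m^(2n)) \<le> 1\<close>, which is an upper bound \<open>c\<close> on \<open>x\<close>, and \<open>x\<close> integrates to \<open>c\<^sup>2/2\<close> up to it.
\<close>
lemma measure_lame_sector:
  assumes n: "n \<ge> 1" and \<alpha>: "0 \<le> \<alpha>" "\<alpha> < pi / 2"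
  shows "measure lebesgue (lame_sector n \<alpha>) =
    integral {0..tan \<alpha>} (\<lambda>m. (1 + m ^ (2 * n)) powr (- 1 / real n)) / 2"
proof -
  let ?S = "lame_sector n \<alpha>" and ?T = "tan \<alpha>"
  let ?f = "\<lambda>m::real. (1 + m ^ (2 * n)) powr (- 1 / real n) / 2"
  have pos: "1 + m ^ (2 * n) > 0" for m :: real
    by (simp add: power_mult add_pos_nonneg)
  have pos_ne: "1 + m ^ (2 * n) \<noteq> 0" for m :: real
    using pos[of m] by simp
  have "closed ?S"
    unfolding lame_sector_eq[OF \<alpha>] case_prod_unfold
    by (intro closed_Collect_conj closed_Collect_le continuous_intros)
  then have S: "?S \<in> sets borel" by simp
  have inner: "(\<integral>\<^sup>+x. ennreal \<bar>x\<bar> * indicator ?S (x, x * m) \<partial>lborel) =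
      ennreal (?f m) * indicator {0..?T} m" for m
  proof -
    define c where "c = (1 + m ^ (2 * n)) powr (- 1 / (2 * real n))"
    have c: "c > 0" using pos_ne[of m] by (simp add: c_def)
    have c_pow: "c ^ (2 * n) * (1 + m ^ (2 * n)) = 1"
    proof -
      have "c ^ (2 * n) = (1 + m ^ (2 * n)) powr (- 1)"
        using n pos[of m] by (simp add: c_def powr_power)
      then show ?thesis using pos[of m] by (simp add: powr_minus)
    qed
    have in_S: "(x, x * m) \<in> ?S \<longleftrightarrow> x \<le> c \<and> m \<in> {0..?T}" if "x > 0" for x
    proof -
      have "x ^ (2 * n) + (x * m) ^ (2 * n) \<le> 1 \<longleftrightarrow>
          x ^ (2 * n) * (1 + m ^ (2 * n)) \<le> c ^ (2 * n) * (1 + m ^ (2 * n))"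
        unfolding c_pow by (simp add: power_mult_distrib distrib_left)
      also have "\<dots> \<longleftrightarrow> x \<le> c"
        using pos[of m] that c n by (simp add: power_mono_iff)
      finally show ?thesis
        using that by (auto simp: lame_sector_eq[OF \<alpha>] zero_le_mult_iff)
    qed
    have not_S: "(x, x * m) \<notin> ?S" if "x < 0" for x
      using that by (simp add: lame_sector_eq[OF \<alpha>])
    have "(\<integral>\<^sup>+x. ennreal \<bar>x\<bar> * indicator ?S (x, x * m) \<partial>lborel) =
        (\<integral>\<^sup>+x. (ennreal x * indicator {0..c} x) * indicator {0..?T} m \<partial>lborel)"
    proof (rule nn_integral_cong)
      fix x :: real
      show "ennreal \<bar>x\<bar> * indicator ?S (x, x * m) =
          (ennreal x * indicator {0..c} x) * indicator {0..?T} m"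
        using in_S[of x] not_S[of x]
        by (cases x "0::real" rule: linorder_cases) (auto simp: indicator_def)
    qed
    also have "\<dots> = (\<integral>\<^sup>+x. ennreal x * indicator {0..c} x \<partial>lborel) * indicator {0..?T} m"
      by (rule nn_integral_multc) measurable
    also have "(\<integral>\<^sup>+x. ennreal x * indicator {0..c} x \<partial>lborel) = ennreal (c\<^sup>2 / 2 - 0\<^sup>2 / 2)"
      by (rule nn_integral_FTC_Icc) (use c in \<open>auto intro!: derivative_eq_intros\<close>)
    also have "c\<^sup>2 / 2 - 0\<^sup>2 / 2 = ?f m"
      using n pos[of m] by (simp add: c_def powr_power)
    finally show ?thesis .
  qed
  have f_int: "(?f has_integral integral {0..?T} ?f) {0..?T}"
    by (intro integrable_integral integrable_continuous_real continuous_intros)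
      (auto simp: pos_ne)
  have "emeasure lborel ?S = (\<integral>\<^sup>+m. ennreal (?f m) * indicator {0..?T} m \<partial>lborel)"
    unfolding emeasure_slope_coordinates[OF S] inner ..
  also have "\<dots> = ennreal (integral {0..?T} ?f)"
    using nn_integral_has_integral_lebesgue[OF _ f_int]
    by (simp add: ennreal_indicator[symmetric] ennreal_mult'[symmetric] mult.commute del: ennreal_indicator)
  finally have "measure lborel ?S = integral {0..?T} ?f"
    using has_integral_nonneg[OF f_int] unfolding measure_def by (simp only: enn2real_ennreal) simp
  then show ?thesis
    using S by (simp add: measure_completion)
qed

section \<open>Length of the sinusoidal spiral\<close>

text \<open>
  The substitution \<open>\<phi>\<close> below is the rational parametrization of \<open>(cos(n\<theta>), sin(n\<theta>))\<close> by the
  half-angle tangent \<open>t^n\<close> of \<open>pi/2 - n\<theta>\<close>. The bound \<open>T \<le> 1\<close> keeps \<open>n\<theta>\<close> in \<open>[0, pi/2]\<close>,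
  where the arccosine recovers \<open>n\<theta>\<close> from its cosine.
\<close>
lemma curve_length_sinusoidal_spiral:
  assumes n: "n \<ge> 1" and T: "0 \<le> T" "T \<le> 1"
  shows "curve_length (sinusoidal_spiral n)
      (1 / real n * arccos (2 * T ^ n / (1 + T ^ (2 * n)))) (pi / (2 * real n)) =
    ennreal (2 powr (1 / real n) * integral {0..T} (\<lambda>t. (1 + t ^ (2 * n)) powr (- 1 / real n)))"
proof -
  define \<phi> where "\<phi> = (\<lambda>t::real. (pi / 2 - 2 * arctan (t ^ n)) / real n)"
  define q where "q = (\<lambda>t::real. 1 + t ^ (2 * n))"
  define r where "r = (\<lambda>t. 2 powr (1 / real n) * t * q t powr (- 1 / real n))"
  define r' where "r' = (\<lambda>t. 2 powr (1 / real n) * q t powr (- 1 / real n) * ((1 - t ^ (2 * n)) / q t))"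
  define \<phi>' where "\<phi>' = (\<lambda>t. - 2 * t ^ (n - 1) / q t)"
  define g where "g = (\<lambda>t. (r t * cos (\<phi> t), r t * sin (\<phi> t)))"
  define g' where "g' = (\<lambda>t. (r' t * cos (\<phi> t) - r t * \<phi>' t * sin (\<phi> t),
                             r' t * sin (\<phi> t) + r t * \<phi>' t * cos (\<phi> t)))"
  have q: "q t > 0" for t by (simp add: q_def power_mult add_pos_nonneg)
  have q_ne: "q t \<noteq> 0" for t using q[of t] by simp
  have q_sq: "q t = 1 + (t ^ n)\<^sup>2" for t by (simp add: q_def power_mult[symmetric] mult.commute)
  have tn: "t ^ n = t * t ^ (n - 1)" for t :: real
    using n by (cases n) auto
  have cos_n\<phi>: "cos (real n * \<phi> t) = 2 * t ^ n / q t" for t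
  proof -
    have "cos (real n * \<phi> t) = cos (pi / 2 - 2 * arctan (t ^ n))"
      using n by (simp add: \<phi>_def)
    also have "\<dots> = sin (2 * arctan (t ^ n))"
      by (simp add: sin_cos_eq)
    also have "\<dots> = 2 * t ^ n / q t"
      unfolding sin_double sin_arctan cos_arctan q_sq by (simp add: add_nonneg_nonneg)
    finally show ?thesis .
  qed
  have \<phi>T: "\<phi> T = 1 / real n * arccos (2 * T ^ n / (1 + T ^ (2 * n)))"
  proof -
    have "0 \<le> T ^ n" "T ^ n \<le> 1" using T by (auto simp: power_le_one)
    then have "0 \<le> arctan (T ^ n)" "arctan (T ^ n) \<le> pi / 4"
      using arctan_monotone'[of "T ^ n" 1] by (auto simp: arctan_one)
    then have "0 \<le> real n * \<phi> T" "real n * \<phi> T \<le> pi"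
      using n pi_ge_zero unfolding \<phi>_def by (simp, simp, linarith)
    then show ?thesis
      using n arccos_cos[of "real n * \<phi> T"] cos_n\<phi>[of T] by (simp add: q_def)
  qed
  have \<phi>0: "\<phi> 0 = pi / (2 * real n)" using n by (simp add: \<phi>_def power_0_left)
  \<comment> \<open>For negative \<open>t\<close> and even \<open>n\<close> the root of \<open>t^n\<close> is \<open>- t\<close>, so there \<open>g t\<close> is
    the antipode of the point of the spiral at angle \<open>\<phi> t\<close>.\<close>
  have spiral: "(sinusoidal_spiral n \<circ> \<phi>) t = g t" if "t \<ge> 0" for t
  proof -
    have "root n (cos (real n * \<phi> t)) = root n 2 * t / root n (q t)"
      using n that by (simp add: cos_n\<phi> real_root_divide real_root_mult real_root_power_cancel)
    also have "\<dots> = r t"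
      using n q[of t] by (simp add: r_def root_powr_inverse powr_minus_divide inverse_eq_divide)
    finally show ?thesis by (simp add: sinusoidal_spiral_def g_def Let_def)
  qed
  have d\<phi>: "(\<phi> has_real_derivative \<phi>' t) (at t)" for t
  proof -
    have "((\<lambda>t. pi / 2 - 2 * arctan (t ^ n)) has_real_derivative
        - (2 * (real n * t ^ (n - 1)) / (1 + (t ^ n)\<^sup>2))) (at t)"
      by (auto intro!: derivative_eq_intros simp: inverse_eq_divide)
    from DERIV_cdivide[OF this, of "real n"] have "(\<phi> has_real_derivative
        - (2 * (real n * t ^ (n - 1)) / (1 + (t ^ n)\<^sup>2)) / real n) (at t)"
      by (simp add: \<phi>_def)
    then show ?thesis using n by (simp add: \<phi>'_def q_sq[symmetric] inverse_eq_divide)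
  qed
  have dq: "(q has_real_derivative 2 * real n * t ^ (2 * n - 1)) (at t)" for t
    unfolding q_def using n by (auto intro!: derivative_eq_intros)
  have dr: "(r has_real_derivative r' t) (at t)" for t
  proof -
    let ?c = "2 powr (1 / real n)" and ?p = "q t powr (- 1 / real n)"
    have "((\<lambda>t. q t powr (- 1 / real n)) has_real_derivative
        ?p * ((- 1 / real n) * (2 * real n * t ^ (2 * n - 1)) / q t)) (at t)"
      using DERIV_powr[OF dq q DERIV_const[of "- 1 / real n"], of t] q[of t] by simp
    from DERIV_cmult[OF DERIV_mult'[OF DERIV_ident this], of ?c]
    have "(r has_real_derivative
        ?c * (?p + t * (?p * ((- 1 / real n) * (2 * real n * t ^ (2 * n - 1)) / q t)))) (at t)"
      by (simp add: r_def algebra_simps)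
    also have "?c * (?p + t * (?p * ((- 1 / real n) * (2 * real n * t ^ (2 * n - 1)) / q t))) =
       ?c * ?p * ((q t - 2 * (t * t ^ (2 * n - 1))) / q t)"
      using n q[of t] by (simp add: field_simps)
    also have "t * t ^ (2 * n - 1) = t ^ (2 * n)"
      using n by (cases n) auto
    finally show ?thesis by (simp add: r'_def q_def)
  qed
  have dg: "(g has_vector_derivative g' t) (at t)" for t
    unfolding g_def g'_def
    by (intro has_vector_derivative_Pair;
        auto intro!: derivative_eq_intros dr d\<phi> simp: has_real_derivative_iff_has_vector_derivative[symmetric] algebra_simps)
  \<comment> \<open>The velocity is \<open>(r', r * \<phi>')\<close> in the rotating orthonormal frame, so \<open>r'\<^sup>2 + (r * \<phi>')\<^sup>2\<close> is the
    square of the speed.\<close>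
  have speed: "norm (g' t) = 2 powr (1 / real n) * q t powr (- 1 / real n)" for t
  proof -
    let ?v = "2 powr (1 / real n) * q t powr (- 1 / real n)"
    have a: "r' t = ?v * ((1 - (t ^ n)\<^sup>2) / q t)"
      by (simp add: r'_def power_mult[symmetric] mult.commute)
    have b: "r t * \<phi>' t = ?v * (- 2 * t ^ n / q t)"
      by (simp add: r_def \<phi>'_def tn)
    have "(norm (g' t))\<^sup>2 = ((r' t)\<^sup>2 + (r t * \<phi>' t)\<^sup>2) * ((cos (\<phi> t))\<^sup>2 + (sin (\<phi> t))\<^sup>2)"
      unfolding g'_def norm_Pair real_norm_def power2_abs real_sqrt_pow2[OF sum_power2_ge_zero]
      by algebra
    also have "\<dots> = ?v\<^sup>2 * (((1 - (t ^ n)\<^sup>2)\<^sup>2 + (2 * t ^ n)\<^sup>2) / (q t)\<^sup>2)"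
      unfolding a b by (simp add: power_mult_distrib power_divide add_divide_distrib distrib_left)
    also have "(1 - (t ^ n)\<^sup>2)\<^sup>2 + (2 * t ^ n)\<^sup>2 = (q t)\<^sup>2"
      unfolding q_sq by algebra
    finally have "(norm (g' t))\<^sup>2 = ?v\<^sup>2" using q[of t] by simp
    then show ?thesis by (rule power2_eq_imp_eq) auto
  qed
  have cont\<phi>: "continuous_on A \<phi>" for A
    by (rule DERIV_continuous_on[OF has_field_derivative_at_within[OF d\<phi>]])
  have contq: "continuous_on A q" for A
    by (rule DERIV_continuous_on[OF has_field_derivative_at_within[OF dq]])
  have contr: "continuous_on A r" for A
    by (rule DERIV_continuous_on[OF has_field_derivative_at_within[OF dr]])
  have contg': "continuous_on A g'" for A
    unfolding g'_def r'_def \<phi>'_def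
    by (intro continuous_intros cont\<phi> contr contq) (auto simp: q_ne)
  have anti: "\<phi> t < \<phi> s" if "0 \<le> s" "s < t" for s t
  proof -
    have "s ^ n < t ^ n" using that n by (intro power_strict_mono) auto
    then have "arctan (s ^ n) < arctan (t ^ n)" by (rule arctan_monotone)
    then show ?thesis using n by (simp add: \<phi>_def divide_strict_right_mono)
  qed
  have "curve_length (sinusoidal_spiral n) (\<phi> T) (\<phi> 0) =
      curve_length (sinusoidal_spiral n \<circ> \<phi>) 0 T"
    using T anti cont\<phi> by (intro curve_length_antitone_reparametrization) auto
  also have "\<dots> = ennreal (integral {0..T} (\<lambda>t. norm (g' t)))"
    using T spiral
    by (intro curve_length_eq_integral_speed contg')
      (auto intro: has_vector_derivative_transform[OF _ _ has_vector_derivative_at_within[OF dg]])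
  also have "\<dots> = ennreal (2 powr (1 / real n) * integral {0..T} (\<lambda>t. q t powr (- 1 / real n)))"
    by (simp add: speed)
  finally show ?thesis unfolding \<phi>T \<phi>0 q_def .
qed

theorem corollary6:
  fixes n :: nat and \<alpha> T \<beta> :: real
  assumes "n \<ge> 1"
    and "0 \<le> \<alpha>" and "\<alpha> \<le> pi / 4"
    and "T = tan \<alpha>"
    and "\<beta> = 1 / real n * arccos (2 * T ^ n / (1 + T ^ (2 * n)))"
  shows "curve_length (sinusoidal_spiral n) \<beta> (pi / (2 * real n)) =
         ennreal (2 powr (1 + 1 / real n) * measure lebesgue (lame_sector n \<alpha>))"
proof -
  have \<alpha>: "\<alpha> < pi / 2" using assms pi_gt_zero by linarith
  have "0 \<le> T" "T \<le> 1"
    using assms \<alpha> tan_mono_le[of 0 \<alpha>] tan_mono_le[of \<alpha> "pi / 4"] by (auto simp: tan_45)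
  then show ?thesis
    using curve_length_sinusoidal_spiral[of n T] assms \<alpha>
    by (simp add: measure_lame_sector powr_add)
qed

end
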